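(* Let $A$ be a (possibly noncommutative) algebra without zero divisors, and let $x_j\in A$, $j\in I_{\rm f}$, be finitely many prime elements of $A$ such that $$A[x_j^{-1},\ j\in I_{\rm f}]\simeq\mathcal U$$ for some upper quantum cluster algebra $\mathcal U$, and such that, regarding $A$ as a subalgebra of $\mathcal U$ via this isomorphism: (1) $A\subset\overline{\mathcal U}$, where $\overline{\mathcal U}$ is the partially compactified upper quantum cluster algebra associated to $\mathcal U$; and (2) the initial cluster variables of $\mathcal U$ belong to $A$, and the frozen ones are precisely $\{x_j\mid j\in I_{\rm f}\}$. Then $A=\overline{\mathcal U}$.
   Context: **Prime elements.** An element $\Delta$ of a ring $A$ is normal if $\Delta A=A\Delta$. For a domain $A$, a prime element is a nonzero, nonunit, normal element $\Delta\in A$ such that $A/(\Delta)$ is a domain, where $(\Delta)=\Delta A=A\Delta$. **Quantum cluster algebras.** The base ring is $\Bbbk=\mathbb Z[q^{\pm1/2}]$ (or $\mathbb C(q^{1/2})$), $q^{1/2}$ a formal parameter; all algebras are $\Bbbk$-algebras. A quantum seed $\mathbf s=(\widetilde B,\Lambda,(x_i)_{i\in I})$, $I=I_{\rm uf}\sqcup I_{\rm f}$ finite (unfrozen and frozen indices), consists of an integer $I\times I_{\rm uf}$ matrix $\widetilde B=(b_{ik})$ with skew-symmetrizable $I_{\rm uf}\times I_{\rm uf}$ part and a skew-symmetric integer $I\times I$ matrix $\Lambda$ with $\sum_j\Lambda_{ij}b_{jk}=-\delta_{ik}d'_k$, $d'_k\in\mathbb Z_{>0}$. Its quantum torus $\mathcal{LP}(\mathbf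 s)$ is the free $\Bbbk$-module on $x^m$, $m\in\mathbb Z^I$, with $x^g*x^h=q^{\frac12 g^T\Lambda h}x^{g+h}$ and $x_i=x^{f_i}$ ($f_i$ the standard basis); $\overline{\mathcal{LP}}(\mathbf s)$ is the span of the $x^m$ with $m_j\ge0$ for all $j\in I_{\rm f}$. With $[a]_+=\max(a,0)$, the mutation $\mu_k\mathbf s$ at $k\in I_{\rm uf}$ has: $b'_{ij}=-b_{ij}$ if $i=k$ or $j=k$, and $b'_{ij}=b_{ij}+[b_{ik}]_+[b_{kj}]_+-[-b_{ik}]_+[-b_{kj}]_+$ otherwise; $\Lambda'_{ij}=g_i^T\Lambda g_j$ with $g_i=f_i$ for $i\neq k$ and $g_k=-f_k+\sum_j[-b_{jk}]_+f_j$; $x'_i=x_i$ for $i\ne k$ and $x'_k=x^{-f_k+\sum_j[-b_{jk}]_+f_j}+x^{-f_k+\sum_j[b_{jk}]_+f_j}$. All tori of mutated seeds lie in the skew field of fractions of $\mathcal{LP}(\mathbf s)$. Fix an initial seed $\mathbf s$. The partially compactified upper quantum cluster algebra is $\overline{\mathcal U}=\bigcap_{\mathbf s'}\overline{\mathcal{LP}}(\mathbf s')$, over all seeds $\mathbf s'$ obtained from $\mathbf s$ by finitely many mutations, and the upper quantum cluster algebra is $\mathcal U=\overline{\mathcal U}[x_j^{-1}]_{j\in I_{\rm f}}$. *)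

theory Defs
  imports
    "HOL-Algebra.Algebra"
    "HOL-Algebra.Algebraic_Closure_Type"
    "HOL-Library.Poly_Mapping"
begin

section \<open>Noncommutative domains, normal and prime elements\<close>

text \<open>The library's \<^locale>\<open>domain\<close> is commutative, so the noncommutative notion is introduced here.\<close>

locale nc_domain = ring R for R (structure) +
  assumes one_not_zero: "\<one> \<noteq> \<zero>"
    and no_zero_divisors:
      "\<lbrakk>a \<in> carrier R; b \<in> carrier R; a \<otimes> b = \<zero>\<rbrakk> \<Longrightarrow> a = \<zero> \<or> b = \<zero>"

definition normal_element :: "('a, 'm) ring_scheme \<Rightarrow> 'a \<Rightarrow> bool"
  where "normal_element A \<Delta> \<longleftrightarrow>
    \<Delta> \<in> carrier A \<and> \<Delta> <#\<^bsub>A\<^esub> carrier A = carrier A #>\<^bsub>A\<^esub> \<Delta>"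

definition prime_element :: "('a, 'm) ring_scheme \<Rightarrow> 'a \<Rightarrow> bool"
  where "prime_element A \<Delta> \<longleftrightarrow>
    \<Delta> \<noteq> \<zero>\<^bsub>A\<^esub> \<and> \<Delta> \<notin> Units A \<and> normal_element A \<Delta> \<and>
    nc_domain (A Quot (\<Delta> <#\<^bsub>A\<^esub> carrier A))"


section \<open>Noncommutative algebras over a commutative ring\<close>

text \<open>The library's \<^locale>\<open>algebra\<close> requires a commutative multiplication.\<close>

locale nc_algebra = module K A + ring A for K (structure) and A (structure) +
  assumes smult_mult_left:
      "\<lbrakk>c \<in> carrier K; x \<in> carrier A; y \<in> carrier A\<rbrakk>
        \<Longrightarrow> (c \<odot>\<^bsub>A\<^esub> x) \<otimes>\<^bsub>A\<^esub> y = c \<odot>\<^bsub>A\<^esub> (x \<otimes>\<^bsub>A\<^esub> y)"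
    and smult_mult_right:
      "\<lbrakk>c \<in> carrier K; x \<in> carrier A; y \<in> carrier A\<rbrakk>
        \<Longrightarrow> x \<otimes>\<^bsub>A\<^esub> (c \<odot>\<^bsub>A\<^esub> y) = c \<odot>\<^bsub>A\<^esub> (x \<otimes>\<^bsub>A\<^esub> y)"

definition alg_hom ::
    "('k, 'n) ring_scheme \<Rightarrow> ('k, 'a) module \<Rightarrow> ('k, 'b) module \<Rightarrow> ('a \<Rightarrow> 'b) set"
  where "alg_hom K A B =
    {h \<in> ring_hom A B. \<forall>c\<in>carrier K. \<forall>x\<in>carrier A. h (c \<odot>\<^bsub>A\<^esub> x) = c \<odot>\<^bsub>B\<^esub> h x}"

definition alg_iso ::
    "('k, 'n) ring_scheme \<Rightarrow> ('k, 'a) module \<Rightarrow> ('k, 'b) module \<Rightarrow> ('a \<Rightarrow> 'b) set"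
  where "alg_iso K A B = {h \<in> alg_hom K A B. bij_betw h (carrier A) (carrier B)}"


section \<open>Noncommutative localization\<close>

inductive_set mult_closure :: "('a, 'm) monoid_scheme \<Rightarrow> 'a set \<Rightarrow> 'a set"
  for A and G where
    one: "\<one>\<^bsub>A\<^esub> \<in> mult_closure A G"
  | incl: "x \<in> G \<Longrightarrow> x \<in> mult_closure A G"
  | mult: "\<lbrakk>x \<in> mult_closure A G; y \<in> mult_closure A G\<rbrakk> \<Longrightarrow> x \<otimes>\<^bsub>A\<^esub> y \<in> mult_closure A G"

text \<open>
  Ore's notion of a (right) ring of fractions of \<open>A\<close> with respect to a multiplicative set \<open>S\<close>.
  Such an \<open>(L, \<eta>)\<close> has the universal property of the \<open>S\<close>-inverting homomorphisms out of \<open>A\<close>, so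
  it is unique up to a unique isomorphism under \<open>A\<close>.
\<close>

definition ring_of_fractions ::
    "('a, 'm) ring_scheme \<Rightarrow> 'a set \<Rightarrow> ('b, 'n) ring_scheme \<Rightarrow> ('a \<Rightarrow> 'b) \<Rightarrow> bool"
  where "ring_of_fractions A S L \<eta> \<longleftrightarrow>
    ring L \<and> \<eta> \<in> ring_hom A L \<and>
    (\<forall>s\<in>S. \<eta> s \<in> Units L) \<and>
    (\<forall>y\<in>carrier L. \<exists>a\<in>carrier A. \<exists>s\<in>S. y = \<eta> a \<otimes>\<^bsub>L\<^esub> inv\<^bsub>L\<^esub> (\<eta> s)) \<and>
    (\<forall>a\<in>carrier A. \<eta> a = \<zero>\<^bsub>L\<^esub> \<longleftrightarrow> (\<exists>s\<in>S. a \<otimes>\<^bsub>A\<^esub> s = \<zero>\<^bsub>A\<^esub>))"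

text \<open>\<open>(L, \<eta>)\<close> is the \<open>K\<close>-algebra \<open>A[x\<inverse>, x \<in> G]\<close>.\<close>

definition alg_localization ::
    "('k, 'n) ring_scheme \<Rightarrow> ('k, 'a) module \<Rightarrow> 'a set \<Rightarrow> ('k, 'l) module \<Rightarrow> ('a \<Rightarrow> 'l) \<Rightarrow> bool"
  where "alg_localization K A G L \<eta> \<longleftrightarrow>
    nc_algebra K L \<and> \<eta> \<in> alg_hom K A L \<and> ring_of_fractions A (mult_closure A G) L \<eta>"

text \<open>That \<open>F\<close> is a skew field follows: all nonzero elements of \<open>A\<close> become units.\<close>

definition skew_field_of_fractions ::
    "('k, 'n) ring_scheme \<Rightarrow> ('k, 'a) module \<Rightarrow> ('k, 'f) module \<Rightarrow> ('a \<Rightarrow> 'f) \<Rightarrow> bool"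
  where "skew_field_of_fractions K A F \<iota> \<longleftrightarrow>
    nc_algebra K F \<and> \<iota> \<in> alg_hom K A F \<and> ring_of_fractions A (carrier A - {\<zero>\<^bsub>A\<^esub>}) F \<iota>"


section \<open>The base ring\<close>

text \<open>
  The type \<^typ>\<open>'k\<close> with the element \<open>qh\<close> (standing for \<open>q\<close> to the power one half) is
  either the ring of integral Laurent polynomials in \<open>qh\<close>, represented as the group ring
  \<^typ>\<open>int \<Rightarrow>\<^sub>0 int\<close> of the integers, or the field of complex rational functions in \<open>qh\<close>.
\<close>

definition quantum_base_ring :: "'k::comm_ring_1 \<Rightarrow> bool"
  where "quantum_base_ring qh \<longleftrightarrow>
    (\<exists>h \<in> ring_iso (ring_of_type_algebra :: (int \<Rightarrow>\<^sub>0 int) ring) (ring_of_type_algebra :: 'k ring).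
        h (Poly_Mapping.single 1 1) = qh) \<or>
    (\<exists>h \<in> ring_iso (ring_of_type_algebra :: complex poly fract ring) (ring_of_type_algebra :: 'k ring).
        h (Fract [:0, 1:] 1) = qh)"

text \<open>\<open>qh_pow qh a\<close> is \<open>q\<close> to the power \<open>a / 2\<close>, for a possibly negative integer \<open>a\<close>.\<close>

definition qh_pow :: "'k::comm_ring_1 \<Rightarrow> int \<Rightarrow> 'k"
  where "qh_pow qh a = qh [^]\<^bsub>(ring_of_type_algebra :: 'k ring)\<^esub> a"


section \<open>Quantum tori\<close>

text \<open>
  Exponents in \<open>\<int>\<^sup>I\<close> are the elements of \<^typ>\<open>'i \<Rightarrow>\<^sub>0 int\<close> supported on \<open>I\<close>.
  Integer matrices are functions of which only the entries with the relevant indices matter.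
\<close>

type_synonym ('k, 'i) laurent = "('i \<Rightarrow>\<^sub>0 int) \<Rightarrow>\<^sub>0 'k"

definition bilin :: "'i set \<Rightarrow> ('i \<Rightarrow> 'i \<Rightarrow> int) \<Rightarrow> ('i \<Rightarrow>\<^sub>0 int) \<Rightarrow> ('i \<Rightarrow>\<^sub>0 int) \<Rightarrow> int"
  where "bilin I \<Lambda> g h =
    (\<Sum>i\<in>I. \<Sum>j\<in>I. Poly_Mapping.lookup g i * \<Lambda> i j * Poly_Mapping.lookup h j)"

definition quantum_torus ::
    "'k::comm_ring_1 \<Rightarrow> 'i set \<Rightarrow> ('i \<Rightarrow> 'i \<Rightarrow> int) \<Rightarrow> ('k, ('k, 'i) laurent) module"
  where "quantum_torus qh I \<Lambda> =
    \<lparr>carrier = {p. \<forall>m\<in>Poly_Mapping.keys p. Poly_Mapping.keys m \<subseteq> I},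
     monoid.mult = (\<lambda>p r. \<Sum>g\<in>Poly_Mapping.keys p. \<Sum>h\<in>Poly_Mapping.keys r.
        Poly_Mapping.single (g + h)
          (qh_pow qh (bilin I \<Lambda> g h) * (Poly_Mapping.lookup p g * Poly_Mapping.lookup r h))),
     one = Poly_Mapping.single 0 1,
     ring.zero = 0,
     add = (\<lambda>p r. p + r),
     module.smult = (\<lambda>c p. Poly_Mapping.map (\<lambda>b. c * b) p)\<rparr>"

text \<open>The basis element \<open>x\<^sup>m\<close>, and the standard basis vector of the exponent lattice.\<close>

definition tmono :: "('i \<Rightarrow>\<^sub>0 int) \<Rightarrow> ('k::comm_ring_1, 'i) laurent"
  where "tmono m = Poly_Mapping.single m 1"

definition std_basis :: "'i \<Rightarrow> ('i \<Rightarrow>\<^sub>0 int)"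
  where "std_basis i = Poly_Mapping.single i 1"


section \<open>Quantum seeds and their mutations\<close>

text \<open>
  The cluster variables of a seed are taken in an ambient algebra \<open>F\<close>, which will be the skew
  field of fractions of the quantum torus of the initial seed.
\<close>

record ('i, 'f) quantum_seed =
  exch :: "'i \<Rightarrow> 'i \<Rightarrow> int"
  quasi :: "'i \<Rightarrow> 'i \<Rightarrow> int"
  cvar :: "'i \<Rightarrow> 'f"

definition compatible_pair ::
    "'i set \<Rightarrow> 'i set \<Rightarrow> ('i \<Rightarrow> 'i \<Rightarrow> int) \<Rightarrow> ('i \<Rightarrow> 'i \<Rightarrow> int) \<Rightarrow> bool"
  where "compatible_pair Iuf Ifr B \<Lambda> \<longleftrightarrow>
    (\<exists>d :: 'i \<Rightarrow> int. (\<forall>i\<in>Iuf. d i > 0) \<and> (\<forall>i\<in>Iuf. \<forall>j\<in>Iuf. d i * B i j = - (d j * B j i))) \<and>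
    (\<forall>i\<in>Iuf \<union> Ifr. \<forall>j\<in>Iuf \<union> Ifr. \<Lambda> i j = - \<Lambda> j i) \<and>
    (\<exists>d' :: 'i \<Rightarrow> int. (\<forall>k\<in>Iuf. d' k > 0) \<and>
      (\<forall>i\<in>Iuf \<union> Ifr. \<forall>k\<in>Iuf. (\<Sum>j\<in>Iuf \<union> Ifr. \<Lambda> i j * B j k) = (if i = k then - d' k else 0)))"

text \<open>
  \<open>s\<close> is an initial seed with index set the disjoint union of \<open>Iuf\<close> and \<open>Ifr\<close>, and \<open>F\<close> is the skew
  field of fractions of its quantum torus, which is embedded by \<open>\<iota>\<close>.
\<close>

definition initial_seed ::
    "'k::comm_ring_1 \<Rightarrow> 'i set \<Rightarrow> 'i set \<Rightarrow> ('k, 'f) module \<Rightarrow> (('k, 'i) laurent \<Rightarrow> 'f)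
      \<Rightarrow> ('i, 'f) quantum_seed \<Rightarrow> bool"
  where "initial_seed qh Iuf Ifr F \<iota> s \<longleftrightarrow>
    finite Iuf \<and> finite Ifr \<and> Iuf \<inter> Ifr = {} \<and>
    compatible_pair Iuf Ifr (exch s) (quasi s) \<and>
    skew_field_of_fractions (ring_of_type_algebra :: 'k ring)
      (quantum_torus qh (Iuf \<union> Ifr) (quasi s)) F \<iota> \<and>
    (\<forall>i\<in>Iuf \<union> Ifr. cvar s i = \<iota> (tmono (std_basis i)))"

text \<open>
  How the quantum torus of a seed lies in \<open>F\<close>: by the algebra homomorphism sending the standard
  generators to the cluster variables.  There is such a homomorphism for each seed obtained from
  an initial seed by mutations, since there the cluster variables are invertible in \<open>F\<close> and
  quasi-commute as prescribed by the matrix; on the quantum torus it is unique, because the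
  generators and their inverses generate.  For an initial seed it agrees with \<open>\<iota>\<close> on the
  quantum torus.
\<close>

definition torus_map ::
    "'k::comm_ring_1 \<Rightarrow> 'i set \<Rightarrow> ('k, 'f) module \<Rightarrow> ('i, 'f) quantum_seed \<Rightarrow> ('k, 'i) laurent \<Rightarrow> 'f"
  where "torus_map qh I F s = (SOME h.
    h \<in> alg_hom (ring_of_type_algebra :: 'k ring) (quantum_torus qh I (quasi s)) F \<and>
    (\<forall>i\<in>I. h (tmono (std_basis i)) = cvar s i))"

definition pos_part :: "int \<Rightarrow> int"
  where "pos_part a = max a 0"

definition mut_exch :: "'i \<Rightarrow> ('i \<Rightarrow> 'i \<Rightarrow> int) \<Rightarrow> ('i \<Rightarrow> 'i \<Rightarrow> int)"
  where "mut_exch k B = (\<lambda>i j.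
    if i = k \<or> j = k then - B i j
    else B i j + pos_part (B i k) * pos_part (B k j) - pos_part (- B i k) * pos_part (- B k j))"

definition mut_exponent_neg :: "'i set \<Rightarrow> ('i \<Rightarrow> 'i \<Rightarrow> int) \<Rightarrow> 'i \<Rightarrow> ('i \<Rightarrow>\<^sub>0 int)"
  where "mut_exponent_neg I B k =
    - std_basis k + (\<Sum>j\<in>I. Poly_Mapping.single j (pos_part (- B j k)))"

definition mut_exponent_pos :: "'i set \<Rightarrow> ('i \<Rightarrow> 'i \<Rightarrow> int) \<Rightarrow> 'i \<Rightarrow> ('i \<Rightarrow>\<^sub>0 int)"
  where "mut_exponent_pos I B k =
    - std_basis k + (\<Sum>j\<in>I. Poly_Mapping.single j (pos_part (B j k)))"

definition mut_quasi ::
    "'i set \<Rightarrow> 'i \<Rightarrow> ('i \<Rightarrow> 'i \<Rightarrow> int) \<Rightarrow> ('i \<Rightarrow> 'i \<Rightarrow> int) \<Rightarrow> ('i \<Rightarrow> 'i \<Rightarrow> int)"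
  where "mut_quasi I k B \<Lambda> =
    (let g = (\<lambda>i. if i = k then mut_exponent_neg I B k else std_basis i)
     in (\<lambda>i j. bilin I \<Lambda> (g i) (g j)))"

definition mutate ::
    "'k::comm_ring_1 \<Rightarrow> 'i set \<Rightarrow> ('k, 'f) module \<Rightarrow> 'i \<Rightarrow> ('i, 'f) quantum_seed
      \<Rightarrow> ('i, 'f) quantum_seed"
  where "mutate qh I F k s =
    \<lparr>exch = mut_exch k (exch s),
     quasi = mut_quasi I k (exch s) (quasi s),
     cvar = (cvar s)(k :=
       torus_map qh I F s (tmono (mut_exponent_neg I (exch s) k)) \<oplus>\<^bsub>F\<^esub>
       torus_map qh I F s (tmono (mut_exponent_pos I (exch s) k)))\<rparr>"

inductive_set mutation_class ::
    "'k::comm_ring_1 \<Rightarrow> 'i set \<Rightarrow> 'i set \<Rightarrow> ('k, 'f) module \<Rightarrow> ('i, 'f) quantum_seed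
      \<Rightarrow> ('i, 'f) quantum_seed set"
  for qh Iuf Ifr F s where
    initial: "s \<in> mutation_class qh Iuf Ifr F s"
  | step: "\<lbrakk>s' \<in> mutation_class qh Iuf Ifr F s; k \<in> Iuf\<rbrakk>
      \<Longrightarrow> mutate qh (Iuf \<union> Ifr) F k s' \<in> mutation_class qh Iuf Ifr F s"


section \<open>Upper quantum cluster algebras\<close>

definition LP_bar ::
    "'k::comm_ring_1 \<Rightarrow> 'i set \<Rightarrow> 'i set \<Rightarrow> ('k, 'f) module \<Rightarrow> ('i, 'f) quantum_seed \<Rightarrow> 'f set"
  where "LP_bar qh Iuf Ifr F s =
    torus_map qh (Iuf \<union> Ifr) F s `
      {p \<in> carrier (quantum_torus qh (Iuf \<union> Ifr) (quasi s)).
        \<forall>m\<in>Poly_Mapping.keys p. \<forall>j\<in>Ifr. Poly_Mapping.lookup m j \<ge> 0}"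

definition upper_bar ::
    "'k::comm_ring_1 \<Rightarrow> 'i set \<Rightarrow> 'i set \<Rightarrow> ('k, 'f) module \<Rightarrow> ('i, 'f) quantum_seed \<Rightarrow> 'f set"
  where "upper_bar qh Iuf Ifr F s = (\<Inter>s'\<in>mutation_class qh Iuf Ifr F s. LP_bar qh Iuf Ifr F s')"

definition upper ::
    "'k::comm_ring_1 \<Rightarrow> 'i set \<Rightarrow> 'i set \<Rightarrow> ('k, 'f) module \<Rightarrow> ('i, 'f) quantum_seed \<Rightarrow> 'f set"
  where "upper qh Iuf Ifr F s =
    generate_ring F (upper_bar qh Iuf Ifr F s \<union> (\<lambda>j. inv\<^bsub>F\<^esub> (cvar s j)) ` Ifr)"

definition upper_algebra ::
    "'k::comm_ring_1 \<Rightarrow> 'i set \<Rightarrow> 'i set \<Rightarrow> ('k, 'f) module \<Rightarrow> ('i, 'f) quantum_seed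
      \<Rightarrow> ('k, 'f) module"
  where "upper_algebra qh Iuf Ifr F s = F\<lparr>carrier := upper qh Iuf Ifr F s\<rparr>"

end

theory Submission
  imports Defs
begin

text \<open>
  Only the torus of the initial seed is needed.  Let \<open>u\<close> lie in the partially compactified torus
  of the initial seed, and suppose \<open>u x\<^sub>j \<in> A\<close> for a frozen \<open>j\<close>.  Clearing the unfrozen
  denominators of \<open>u\<close> by a monomial \<open>w\<close> in the unfrozen variables gives \<open>w u \<in> A\<close>, so
  \<open>w (u x\<^sub>j) \<in> A x\<^sub>j = (x\<^sub>j)\<close>.  Here \<open>w \<notin> (x\<^sub>j)\<close>: otherwise \<open>x\<^sub>j\<inverse> w \<in> A\<close>, although this
  monomial has exponent \<open>-1\<close> at the frozen index \<open>j\<close>.  As \<open>x\<^sub>j\<close> is prime, \<open>u x\<^sub>j \<in> A x\<^sub>j\<close>, that is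
  \<open>u \<in> A\<close>.  Every element of the upper cluster algebra becomes an element of \<open>A\<close> after right
  multiplication by finitely many of the \<open>x\<^sub>j\<close>, and these can be removed one at a time.
\<close>

section \<open>The base ring\<close>

abbreviation (input) base_alg :: "'k::comm_ring_1 ring"
  where "base_alg \<equiv> ring_of_type_algebra"

lemma base_alg_simps [simp]:
  "carrier base_alg = UNIV" "x \<otimes>\<^bsub>base_alg\<^esub> y = x * y" "\<one>\<^bsub>base_alg\<^esub> = 1"
  by (simp_all add: ring_of_type_algebra_def)

lemma Units_base_alg: "Units (base_alg :: 'k::comm_ring_1 ring) = {c. c dvd 1}"
proof -
  have "c \<in> Units (base_alg :: 'k ring) \<longleftrightarrow> c dvd 1" for c :: 'k
    by (simp add: Units_def dvd_def mult.commute[of _ c] eq_commute[of 1])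
  then show ?thesis by blast
qed

text \<open>Both base rings have an explicit inverse of \<open>qh\<close>, the monomial of exponent
  \<open>-1\<close> or the fraction \<open>1/X\<close>, and a ring isomorphism transports it. This
  lets powers of \<open>q\<close> be divided out below.\<close>

lemma quantum_base_ring_dvd_one:
  fixes qh :: "'k::comm_ring_1"
  assumes "quantum_base_ring qh"
  shows "qh dvd 1"
  using assms unfolding quantum_base_ring_def
proof (elim disjE bexE)
  fix h assume h: "h \<in> ring_iso (base_alg :: (int \<Rightarrow>\<^sub>0 int) ring) (base_alg :: 'k ring)"
    and qh: "h (Poly_Mapping.single 1 1) = qh"
  have "qh * h (Poly_Mapping.single (-1) 1) = h (Poly_Mapping.single 1 1 * Poly_Mapping.single (-1) 1)"
    using h qh by (auto simp: ring_iso_def ring_hom_def)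
  also have "\<dots> = 1"
    using h by (auto simp: ring_iso_def ring_hom_def mult_single)
  finally show ?thesis by (metis dvdI)
next
  fix h assume h: "h \<in> ring_iso (base_alg :: complex poly fract ring) (base_alg :: 'k ring)"
    and qh: "h (Fract [:0, 1:] 1) = qh"
  have "qh * h (Fract 1 [:0, 1:]) = h (Fract [:0, 1:] 1 * Fract 1 [:0, 1:])"
    using h qh by (auto simp: ring_iso_def ring_hom_def simp del: mult_fract)
  also have "Fract [:0, 1:] 1 * Fract 1 [:0, 1 :: complex:] = 1"
    by (simp add: One_fract_def eq_fract)
  also have "h 1 = 1"
    using h by (auto simp: ring_iso_def ring_hom_def)
  finally show ?thesis by (metis dvdI)
qed

lemma qh_pow_0 [simp]: "qh_pow qh 0 = 1"
  by (simp add: qh_pow_def)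

lemma qh_pow_dvd_one:
  fixes qh :: "'k::comm_ring_1"
  assumes "qh dvd 1"
  shows "qh_pow qh a dvd 1"
proof -
  interpret K: cring "base_alg :: 'k ring" by (rule cring_from_type_algebra)
  have "qh [^]\<^bsub>base_alg\<^esub> n \<in> Units base_alg" for n :: nat
    using assms by (intro K.Units_pow_closed) (simp add: Units_base_alg)
  then have "qh [^]\<^bsub>base_alg\<^esub> a \<in> Units base_alg"
    by (simp only: int_pow_def2 K.Units_inv_Units split: if_split) simp
  then show ?thesis
    by (simp add: Units_base_alg qh_pow_def)
qed

section \<open>Exponents\<close>

lemma lookup_std_basis: "Poly_Mapping.lookup (std_basis i) j = (if i = j then 1 else 0)"
  by (simp add: std_basis_def lookup_single when_def)

lemma keys_std_basis [simp]: "Poly_Mapping.keys (std_basis i) = {i}"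
  by (simp add: std_basis_def)

text \<open>Up to a power of \<open>q\<close>, these are the exponents of the products of generators
  indexed by \<open>I\<close>, with no inverses.\<close>

definition nonneg_exponents :: "'i set \<Rightarrow> ('i \<Rightarrow>\<^sub>0 int) set"
  where "nonneg_exponents I = {m. Poly_Mapping.keys m \<subseteq> I \<and> (\<forall>i. Poly_Mapping.lookup m i \<ge> 0)}"

lemma nonneg_exponents_mono: "I \<subseteq> J \<Longrightarrow> nonneg_exponents I \<subseteq> nonneg_exponents J"
  by (auto simp: nonneg_exponents_def)

lemma std_basis_nonneg [simp]: "std_basis i \<in> nonneg_exponents I \<longleftrightarrow> i \<in> I"
  by (auto simp: nonneg_exponents_def lookup_std_basis)

lemma zero_nonneg [simp]: "0 \<in> nonneg_exponents I"
  by (simp add: nonneg_exponents_def)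

text \<open>Induction on total degree: lowering a positive coordinate by one stays in the set. It
  carries facts from the generators to all polynomial monomials.\<close>

lemma nonneg_exponents_induct [consumes 1, case_names zero add]:
  assumes "m \<in> nonneg_exponents I"
    and zero: "P 0"
    and add: "\<And>m i. m \<in> nonneg_exponents I \<Longrightarrow> i \<in> I \<Longrightarrow> P m \<Longrightarrow> P (m + std_basis i)"
  shows "P m"
  using assms(1)
proof (induction "nat (\<Sum>i\<in>Poly_Mapping.keys m. Poly_Mapping.lookup m i)" arbitrary: m
    rule: less_induct)
  case less
  show ?case
  proof (cases "m = 0")
    case True
    then show ?thesis using zero by simp
  next
    case False
    then obtain i where i: "i \<in> Poly_Mapping.keys m"
      by (metis all_not_in_conv keys_eq_empty)
    define n where "n = m - std_basis i"
    have m: "m = n + std_basis i" by (simp add: n_def)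
    have pos: "Poly_Mapping.lookup m i \<ge> 1"
    proof -
      have "Poly_Mapping.lookup m i \<ge> 0" "Poly_Mapping.lookup m i \<noteq> 0"
        using less.prems i by (simp_all add: nonneg_exponents_def in_keys_iff)
      then show ?thesis by linarith
    qed
    have lookup_n: "Poly_Mapping.lookup n j = Poly_Mapping.lookup m j - (if i = j then 1 else 0)" for j
      by (simp add: n_def lookup_minus lookup_std_basis)
    have keys_n: "Poly_Mapping.keys n \<subseteq> Poly_Mapping.keys m"
      using i pos by (auto simp: in_keys_iff lookup_n split: if_splits)
    have n: "n \<in> nonneg_exponents I"
      using less.prems keys_n pos by (auto simp: nonneg_exponents_def lookup_n)
    have "(\<Sum>j\<in>Poly_Mapping.keys n. Poly_Mapping.lookup n j)
        = (\<Sum>j\<in>Poly_Mapping.keys m. Poly_Mapping.lookup n j)"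
      by (rule sum.mono_neutral_left) (use keys_n in \<open>auto simp: in_keys_iff\<close>)
    also have "\<dots> = (\<Sum>j\<in>Poly_Mapping.keys m. Poly_Mapping.lookup m j) - 1"
      using i by (simp add: lookup_n sum_subtractf)
    finally have eq: "(\<Sum>j\<in>Poly_Mapping.keys n. Poly_Mapping.lookup n j) = \<dots>" .
    \<comment> \<open>The degree of \<open>m\<close> is therefore at least 1, so subtracting 1
      strictly decreases it even after truncation by \<open>nat\<close>.\<close>
    have "Poly_Mapping.lookup m i \<le> (\<Sum>j\<in>Poly_Mapping.keys m. Poly_Mapping.lookup m j)"
      by (rule member_le_sum) (use i less.prems in \<open>auto simp: nonneg_exponents_def\<close>)
    then have "P n"
      using eq pos n by (intro less.hyps) auto
    then show ?thesis
      unfolding m using n i less.prems by (intro add) (auto simp: nonneg_exponents_def)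
  qed
qed

text \<open>Take for \<open>n\<close> the sum of the negative parts of all \<open>m\<close> in
  \<open>M\<close>; it dominates each of them. Negative coordinates occur only in \<open>J\<close>,
  so \<open>n\<close> is supported there.\<close>

lemma clear_denominators:
  fixes M :: "('i \<Rightarrow>\<^sub>0 int) set"
  assumes "finite M" and keys: "\<And>m. m \<in> M \<Longrightarrow> Poly_Mapping.keys m \<subseteq> I"
    and nonneg: "\<And>m i. m \<in> M \<Longrightarrow> i \<in> I - J \<Longrightarrow> Poly_Mapping.lookup m i \<ge> 0"
    and "J \<subseteq> I"
  obtains n where "n \<in> nonneg_exponents J" "\<And>m. m \<in> M \<Longrightarrow> m + n \<in> nonneg_exponents I"
proof -
  \<comment> \<open>The negative part of \<open>m\<close>; the function sends 0 to 0, so the formula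
    also holds off the support.\<close>
  define f where "f m = Poly_Mapping.map (\<lambda>a. max 0 (- a)) m" for m :: "'i \<Rightarrow>\<^sub>0 int"
  have f: "Poly_Mapping.lookup (f m) i = max 0 (- Poly_Mapping.lookup m i)" for m i
    by (simp add: f_def Poly_Mapping.map.rep_eq when_def)
  define n where "n = sum f M"
  have n: "Poly_Mapping.lookup n i = (\<Sum>m\<in>M. max 0 (- Poly_Mapping.lookup m i))" for i
    by (simp add: n_def lookup_sum f)
  have "i \<in> J" if "i \<in> Poly_Mapping.keys n" for i
  proof -
    from that have "(\<Sum>m\<in>M. max 0 (- Poly_Mapping.lookup m i)) \<noteq> 0"
      by (simp add: in_keys_iff n)
    then obtain m where m: "m \<in> M" "max 0 (- Poly_Mapping.lookup m i) \<noteq> 0"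
      by (rule sum.not_neutral_contains_not_neutral)
    then have neg: "Poly_Mapping.lookup m i < 0" by linarith
    then have "i \<in> Poly_Mapping.keys m" by (simp add: in_keys_iff)
    then have "i \<in> I" using keys[OF m(1)] by blast
    then show ?thesis using neg nonneg[OF m(1), of i] by force
  qed
  then have n_J: "n \<in> nonneg_exponents J"
    by (auto simp: nonneg_exponents_def n intro: sum_nonneg)
  have "m + n \<in> nonneg_exponents I" if m: "m \<in> M" for m
  proof -
    have "Poly_Mapping.lookup (m + n) i \<ge> 0" for i
    proof -
      have "max 0 (- Poly_Mapping.lookup m i) \<le> Poly_Mapping.lookup n i"
        unfolding n by (rule member_le_sum[OF m]) (use \<open>finite M\<close> in auto)
      then show ?thesis by (simp add: lookup_add)
    qed
    moreover have "Poly_Mapping.keys (m + n) \<subseteq> I"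
      using keys[OF m] n_J \<open>J \<subseteq> I\<close> keys_add[of m n] by (auto simp: nonneg_exponents_def)
    ultimately show ?thesis by (simp add: nonneg_exponents_def)
  qed
  with n_J show ?thesis using that by blast
qed

section \<open>The quantum torus\<close>

lemma quantum_torus_simps [simp]:
  "p \<in> carrier (quantum_torus qh I \<Lambda>) \<longleftrightarrow> (\<forall>m\<in>Poly_Mapping.keys p. Poly_Mapping.keys m \<subseteq> I)"
  "\<one>\<^bsub>quantum_torus qh I \<Lambda>\<^esub> = Poly_Mapping.single 0 1"
  "\<zero>\<^bsub>quantum_torus qh I \<Lambda>\<^esub> = 0"
  "p \<oplus>\<^bsub>quantum_torus qh I \<Lambda>\<^esub> r = p + r"
  "c \<odot>\<^bsub>quantum_torus qh I \<Lambda>\<^esub> p = Poly_Mapping.map (\<lambda>b. c * b) p"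
  by (simp_all add: quantum_torus_def)

lemma quantum_torus_mult:
  "p \<otimes>\<^bsub>quantum_torus qh I \<Lambda>\<^esub> r = (\<Sum>g\<in>Poly_Mapping.keys p. \<Sum>h\<in>Poly_Mapping.keys r.
     Poly_Mapping.single (g + h)
       (qh_pow qh (bilin I \<Lambda> g h) * (Poly_Mapping.lookup p g * Poly_Mapping.lookup r h)))"
  by (simp add: quantum_torus_def)

text \<open>Every term of the product sits at a sum of two support exponents. Cancellation can only
  shrink the support, so only this inclusion is claimed.\<close>

lemma keys_torus_multE:
  assumes "m \<in> Poly_Mapping.keys (p \<otimes>\<^bsub>quantum_torus qh I \<Lambda>\<^esub> r)"
  obtains g h where "m = g + h" "g \<in> Poly_Mapping.keys p" "h \<in> Poly_Mapping.keys r"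
proof -
  obtain g where g: "g \<in> Poly_Mapping.keys p"
    and "m \<in> Poly_Mapping.keys (\<Sum>h\<in>Poly_Mapping.keys r. Poly_Mapping.single (g + h)
       (qh_pow qh (bilin I \<Lambda> g h) * (Poly_Mapping.lookup p g * Poly_Mapping.lookup r h)))"
    using assms unfolding quantum_torus_mult using keys_sum by fast
  then obtain h where "h \<in> Poly_Mapping.keys r"
    and "m \<in> Poly_Mapping.keys (Poly_Mapping.single (g + h)
       (qh_pow qh (bilin I \<Lambda> g h) * (Poly_Mapping.lookup p g * Poly_Mapping.lookup r h)))"
    using keys_sum by fast
  then show thesis
    using g that by (auto split: if_splits)
qed

lemma tmono_mult:
  "tmono g \<otimes>\<^bsub>quantum_torus qh I \<Lambda>\<^esub> tmono h = Poly_Mapping.single (g + h) (qh_pow qh (bilin I \<Lambda> g h))"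
  by (auto simp: quantum_torus_mult tmono_def)

lemma sum_monomials:
  fixes p :: "'m \<Rightarrow>\<^sub>0 'k::comm_monoid_add"
  shows "(\<Sum>m\<in>Poly_Mapping.keys p. Poly_Mapping.single m (Poly_Mapping.lookup p m)) = p"
  by (rule poly_mapping_eqI) (simp add: lookup_sum lookup_single when_def in_keys_iff)

lemma bilin_zero_left [simp]: "bilin I \<Lambda> 0 h = 0"
  by (simp add: bilin_def)

text \<open>The twist is trivial because the form vanishes at exponent 0. The torus is nowhere shown
  to be a ring here, so this law is checked directly for \<open>iota_eq_zero\<close>.\<close>

lemma torus_one_mult:
  "\<one>\<^bsub>quantum_torus qh I \<Lambda>\<^esub> \<otimes>\<^bsub>quantum_torus qh I \<Lambda>\<^esub> p = p"
  by (simp add: quantum_torus_mult sum_monomials)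

lemma poly_mapping_span_induct [consumes 1, case_names zero monomial add]:
  fixes p :: "'m \<Rightarrow>\<^sub>0 'k::comm_monoid_add"
  assumes "Poly_Mapping.keys p \<subseteq> S"
    and "P 0"
    and "\<And>c m. m \<in> S \<Longrightarrow> P (Poly_Mapping.single m c)"
    and "\<And>p r. \<lbrakk>Poly_Mapping.keys p \<subseteq> S; Poly_Mapping.keys r \<subseteq> S; P p; P r\<rbrakk> \<Longrightarrow> P (p + r)"
  shows "P p"
proof -
  \<comment> \<open>The support bound is carried along because the additive case requires it of both
    summands.\<close>
  have "P (\<Sum>m\<in>M. Poly_Mapping.single m (Poly_Mapping.lookup p m)) \<and>
      Poly_Mapping.keys (\<Sum>m\<in>M. Poly_Mapping.single m (Poly_Mapping.lookup p m)) \<subseteq> S"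
    if "finite M" "M \<subseteq> Poly_Mapping.keys p" for M
    using that
  proof (induction rule: finite_induct)
    case empty
    then show ?case using assms by simp
  next
    case (insert m M)
    let ?p = "\<Sum>m\<in>M. Poly_Mapping.single m (Poly_Mapping.lookup p m)"
    have m: "m \<in> S" using insert assms(1) by auto
    then have "Poly_Mapping.keys (Poly_Mapping.single m (Poly_Mapping.lookup p m)) \<subseteq> S"
      by auto
    with insert m show ?case
      using keys_add[of "Poly_Mapping.single m (Poly_Mapping.lookup p m)" ?p]
      by (auto intro!: assms)
  qed
  from this[of "Poly_Mapping.keys p"] show ?thesis
    by (simp add: sum_monomials)
qed

lemma keys_tmono [simp]: "Poly_Mapping.keys (tmono m :: ('k::comm_ring_1, 'i) laurent) = {m}"
  by (simp add: tmono_def)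

lemma tmono_nonzero [simp]: "tmono m \<noteq> 0"
  by (metis empty_not_insert keys_tmono keys_zero)

text \<open>The twist is a power of \<open>q\<close>, hence a unit, and \<open>d\<close> is its
  inverse. In this form homomorphisms and subalgebras can be followed from generators to
  monomials.\<close>

lemma tmono_add:
  fixes qh :: "'k::comm_ring_1"
  assumes "qh dvd 1"
  obtains d :: 'k where "tmono (g + h)
    = d \<odot>\<^bsub>quantum_torus qh I \<Lambda>\<^esub> (tmono g \<otimes>\<^bsub>quantum_torus qh I \<Lambda>\<^esub> tmono h)"
proof -
  obtain d where "1 = qh_pow qh (bilin I \<Lambda> g h) * d"
    using qh_pow_dvd_one[OF assms] by (rule dvdE)
  then have "1 = d * qh_pow qh (bilin I \<Lambda> g h)"
    by (simp only: mult.commute)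
  then show thesis
    by (intro that[of d]) (simp add: tmono_mult, simp add: tmono_def)
qed

lemma single_eq_smult_tmono:
  "Poly_Mapping.single m c = c \<odot>\<^bsub>quantum_torus qh I \<Lambda>\<^esub> tmono m"
  by (simp add: tmono_def)

section \<open>Algebra homomorphisms out of the quantum torus\<close>

locale torus_hom = F: nc_algebra "base_alg" F
  for qh :: "'k::comm_ring_1" and I :: "'i set" and \<Lambda> and F :: "('k::comm_ring_1, 'f) module" (structure) and h +
  assumes qh_unit: "qh dvd 1"
    and hom: "h \<in> alg_hom base_alg (quantum_torus qh I \<Lambda>) F"
begin

abbreviation T :: "('k, ('k, 'i) laurent) module"
  where "T \<equiv> quantum_torus qh I \<Lambda>"

lemma hom_closed [simp]: "p \<in> carrier T \<Longrightarrow> h p \<in> carrier F"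
  and hom_mult: "p \<in> carrier T \<Longrightarrow> r \<in> carrier T \<Longrightarrow> h (p \<otimes>\<^bsub>T\<^esub> r) = h p \<otimes> h r"
  and hom_add: "p \<in> carrier T \<Longrightarrow> r \<in> carrier T \<Longrightarrow> h (p + r) = h p \<oplus> h r"
  and hom_one: "h (\<one>\<^bsub>T\<^esub>) = \<one>"
  and hom_smult: "p \<in> carrier T \<Longrightarrow> h (c \<odot>\<^bsub>T\<^esub> p) = c \<odot> h p"
  using hom unfolding alg_hom_def ring_hom_def by (auto simp del: quantum_torus_simps(2,5))

lemma hom_zero: "h 0 = \<zero>"
proof -
  \<comment> \<open>\<open>ring_hom\<close> does not include preservation of zero, so it comes from
    additivity and cancellation in \<open>F\<close>.\<close>
  have "h 0 \<oplus> h 0 = h 0"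
    using hom_add[of 0 0] by simp
  then show ?thesis
    using F.add.r_cancel_one[of "h 0" "h 0"] by simp
qed

text \<open>Building a monomial one generator at a time only produces scalar factors, which
  \<open>B\<close> absorbs; sums then give all quantum polynomials in the generators.\<close>

lemma hom_poly_mem:
  assumes B: "subring B F" "\<And>c b. b \<in> B \<Longrightarrow> c \<odot> b \<in> B"
    and J: "J \<subseteq> I" and gens: "\<And>i. i \<in> J \<Longrightarrow> h (tmono (std_basis i)) \<in> B"
    and p: "Poly_Mapping.keys p \<subseteq> nonneg_exponents J"
  shows "h p \<in> B"
proof -
  have mono: "h (tmono m) \<in> B" if "m \<in> nonneg_exponents J" for m
    using that
  proof (induction rule: nonneg_exponents_induct)
    case zero
    then show ?case
      using hom_one subringE(3)[OF B(1)] by (simp add: tmono_def)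
  next
    case (add m i)
    have "Poly_Mapping.keys m \<subseteq> I" "Poly_Mapping.keys (std_basis i) \<subseteq> I"
      using add J by (auto simp: nonneg_exponents_def)
    then have carr: "tmono m \<in> carrier T" "tmono (std_basis i) \<in> carrier T"
      "tmono m \<otimes>\<^bsub>T\<^esub> tmono (std_basis i) \<in> carrier T"
      using keys_add[of m "std_basis i"] by (auto simp: tmono_mult)
    obtain d where d: "tmono (m + std_basis i) = d \<odot>\<^bsub>T\<^esub> (tmono m \<otimes>\<^bsub>T\<^esub> tmono (std_basis i))"
      by (rule tmono_add[OF qh_unit])
    have "h (tmono m) \<otimes> h (tmono (std_basis i)) \<in> B"
      by (intro subringE(6)[OF B(1)] gens add)
    then show ?case
      unfolding d hom_smult[OF carr(3)] hom_mult[OF carr(1,2)] by (rule B(2))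
  qed
  have sub: "p \<in> carrier T" if "Poly_Mapping.keys p \<subseteq> nonneg_exponents J" for p :: "('k, 'i) laurent"
    using that J by (auto simp: nonneg_exponents_def)
  show ?thesis
    using p
  proof (induction rule: poly_mapping_span_induct)
    case zero
    then show ?case
      using hom_zero subringE(2)[OF B(1)] by simp
  next
    case (monomial c m)
    then have "tmono m \<in> carrier T"
      using J by (auto simp: nonneg_exponents_def)
    then show ?case
      using mono[OF monomial] B(2) single_eq_smult_tmono[of m c qh I \<Lambda>] hom_smult by metis
  next
    case (add p r)
    then show ?case
      by (simp only: hom_add[OF sub sub] subringE(7)[OF B(1)])
  qed
qed

end

section \<open>The skew field of fractions of the quantum torus\<close>

locale torus_fractions =
  fixes qh :: "'k::comm_ring_1" and I :: "'i set" and \<Lambda>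
    and F :: "('k, 'f) module" (structure) and \<iota>
  assumes unit: "qh dvd 1"
    and fractions: "skew_field_of_fractions base_alg (quantum_torus qh I \<Lambda>) F \<iota>"

sublocale torus_fractions \<subseteq> torus_hom qh I \<Lambda> F \<iota>
  using unit fractions
  by (auto simp: torus_hom_def torus_hom_axioms_def skew_field_of_fractions_def)

context torus_fractions
begin

lemma iota_unit: "p \<in> carrier T \<Longrightarrow> p \<noteq> 0 \<Longrightarrow> \<iota> p \<in> Units F"
  using fractions unfolding skew_field_of_fractions_def ring_of_fractions_def by simp

text \<open>A nonzero element of the kernel would make \<open>0\<close> a unit of \<open>F\<close>, so zero divisors in the
  quantum torus need not be ruled out first.\<close>

lemma iota_eq_zero:
  assumes p: "p \<in> carrier T" and zero: "\<iota> p = \<zero>"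
  shows "p = 0"
proof (rule ccontr)
  assume "p \<noteq> 0"
  then have "\<zero> \<in> Units F"
    using iota_unit[OF p] zero by simp
  then have "\<one> = \<zero>"
    using F.Units_l_inv_ex by force
  then have "\<iota> \<one>\<^bsub>T\<^esub> = \<zero>"
    using hom_one by simp
  moreover have "\<one>\<^bsub>T\<^esub> \<in> carrier T" by simp
  \<comment> \<open>The kernel clause of \<open>ring_of_fractions\<close>, applied to the unit of
    the torus.\<close>
  ultimately obtain t where "t \<noteq> 0" "\<one>\<^bsub>T\<^esub> \<otimes>\<^bsub>T\<^esub> t = 0"
    using fractions unfolding skew_field_of_fractions_def ring_of_fractions_def
    by (metis DiffD2 quantum_torus_simps(3) singletonI)
  then show False
    by (simp only: torus_one_mult)
qed

lemma iota_inject: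
  assumes p: "p \<in> carrier T" and r: "r \<in> carrier T" and eq: "\<iota> p = \<iota> r"
  shows "p = r"
proof -
  have d: "p - r \<in> carrier T"
    using p r keys_diff[of p r] by simp blast
  then have "\<iota> (p - r) \<oplus> \<iota> r = \<iota> r"
    using hom_add[OF d r] eq by simp
  then have "\<iota> (p - r) = \<zero>"
    using d r F.add.r_cancel_one[of "\<iota> r" "\<iota> (p - r)"] by simp
  then show ?thesis
    using iota_eq_zero[OF d] by simp
qed

lemma tmono_unit: "Poly_Mapping.keys m \<subseteq> I \<Longrightarrow> \<iota> (tmono m) \<in> Units F"
  by (rule iota_unit) auto

text \<open>Monomials with nonnegative exponents are determined by the generators; a general monomial is
  then reached by cancelling its denominator.\<close>

lemma torus_hom_unique:
  assumes g: "g \<in> alg_hom base_alg T F"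
    and gens: "\<And>i. i \<in> I \<Longrightarrow> g (tmono (std_basis i)) = \<iota> (tmono (std_basis i))"
    and p: "p \<in> carrier T"
  shows "g p = \<iota> p"
proof -
  interpret g: torus_hom qh I \<Lambda> F g
    using g unit by unfold_locales
  have poly: "g (tmono m) = \<iota> (tmono m)" if "m \<in> nonneg_exponents I" for m
    using that
  proof (induction rule: nonneg_exponents_induct)
    case zero
    then show ?case using hom_one g.hom_one by (simp add: tmono_def)
  next
    case (add m i)
    have keys: "Poly_Mapping.keys m \<subseteq> I" "Poly_Mapping.keys (std_basis i) \<subseteq> I"
      using add by (auto simp: nonneg_exponents_def)
    then have carr: "tmono m \<in> carrier T" "tmono (std_basis i) \<in> carrier T"
      "tmono m \<otimes>\<^bsub>T\<^esub> tmono (std_basis i) \<in> carrier T"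
      using keys_add[of m "std_basis i"] by (auto simp: tmono_mult)
    obtain d where d: "tmono (m + std_basis i) = d \<odot>\<^bsub>T\<^esub> (tmono m \<otimes>\<^bsub>T\<^esub> tmono (std_basis i))"
      by (rule tmono_add[OF unit])
    show ?case
      unfolding d hom_smult[OF carr(3)] g.hom_smult[OF carr(3)]
        hom_mult[OF carr(1,2)] g.hom_mult[OF carr(1,2)] gens[OF add(2)] add(3) ..
  qed
  have mono: "g (tmono m) = \<iota> (tmono m)" if m: "Poly_Mapping.keys m \<subseteq> I" for m
  proof -
    \<comment> \<open>With \<open>J = I\<close> every coordinate may be cleared, and the sign
      premise is vacuous.\<close>
    obtain n where n: "n \<in> nonneg_exponents I" "m + n \<in> nonneg_exponents I"
      by (rule clear_denominators[of "{m}" I I]) (use m in auto)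
    then have keys: "Poly_Mapping.keys n \<subseteq> I" "Poly_Mapping.keys (m + n) \<subseteq> I"
      by (auto simp: nonneg_exponents_def)
    define c where "c = qh_pow qh (bilin I \<Lambda> m n)"
    have c: "tmono m \<otimes>\<^bsub>T\<^esub> tmono n = c \<odot>\<^bsub>T\<^esub> tmono (m + n)"
      by (simp add: tmono_mult c_def) (simp add: tmono_def)
    have carr: "tmono m \<in> carrier T" "tmono n \<in> carrier T" "tmono (m + n) \<in> carrier T"
      using m keys by auto
    have "g (tmono m) \<otimes> g (tmono n) = c \<odot> g (tmono (m + n))"
      unfolding g.hom_mult[OF carr(1,2), symmetric] c g.hom_smult[OF carr(3)] ..
    also have "\<dots> = \<iota> (tmono m) \<otimes> \<iota> (tmono n)"
      unfolding hom_mult[OF carr(1,2), symmetric] c hom_smult[OF carr(3)] poly[OF n(2)] ..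
    finally have "g (tmono m) \<otimes> g (tmono n) = \<iota> (tmono m) \<otimes> \<iota> (tmono n)" .
    then have eq: "g (tmono m) \<otimes> \<iota> (tmono n) = \<iota> (tmono m) \<otimes> \<iota> (tmono n)"
      using poly[OF n(1)] by simp
    have u: "\<iota> (tmono n) \<in> Units F" by (rule tmono_unit) fact
    have "g (tmono m) = g (tmono m) \<otimes> \<iota> (tmono n) \<otimes> inv \<iota> (tmono n)"
      using u m keys by (simp add: F.m_assoc F.Units_closed)
    also have "\<dots> = \<iota> (tmono m)"
      unfolding eq using u m keys by (simp add: F.m_assoc F.Units_closed)
    finally show ?thesis .
  qed
  have sub: "p \<in> carrier T" if "Poly_Mapping.keys p \<subseteq> {m. Poly_Mapping.keys m \<subseteq> I}"
    for p :: "('k, 'i) laurent"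
    using that by auto
  have "Poly_Mapping.keys p \<subseteq> {m. Poly_Mapping.keys m \<subseteq> I}"
    using p by auto
  then show ?thesis
  proof (induction rule: poly_mapping_span_induct)
    case zero
    then show ?case by (simp add: hom_zero g.hom_zero)
  next
    case (monomial c m)
    then have carr: "tmono m \<in> carrier T" and eq: "g (tmono m) = \<iota> (tmono m)"
      using mono by auto
    show ?case
      unfolding single_eq_smult_tmono[of m c qh I \<Lambda>] hom_smult[OF carr] g.hom_smult[OF carr] eq ..
  next
    case (add p r)
    then show ?case
      by (simp only: hom_add[OF sub sub] g.hom_add[OF sub sub])
  qed
qed

text \<open>\<open>\<iota>\<close> itself satisfies the property by which \<open>torus_map\<close>
  is chosen, so the choice satisfies it too, and uniqueness identifies the two on the torus.\<close>

lemma torus_map_eq: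
  assumes "quasi s = \<Lambda>" and "\<And>i. i \<in> I \<Longrightarrow> cvar s i = \<iota> (tmono (std_basis i))"
    and "p \<in> carrier T"
  shows "torus_map qh I F s p = \<iota> p"
proof -
  have "torus_map qh I F s \<in> alg_hom base_alg T F \<and>
      (\<forall>i\<in>I. torus_map qh I F s (tmono (std_basis i)) = cvar s i)"
    unfolding torus_map_def assms(1)
    by (rule someI[where x = \<iota>]) (intro conjI hom ballI, simp only: assms(2))
  then show ?thesis
    by (intro torus_hom_unique[OF _ _ assms(3)]) (simp_all only: assms(2))
qed

end

section \<open>Ideals generated by prime elements\<close>

text \<open>Normality allows \<open>\<Delta>\<close> to be written on either side: the right-hand
  form absorbs multiplication from the left, and the left-hand form from the right.\<close>

lemma normal_element_ideal:
  assumes "ring R" and "normal_element R \<Delta>"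
  shows "ideal (\<Delta> <#\<^bsub>R\<^esub> carrier R) R"
proof -
  interpret ring R by fact
  have \<Delta>: "\<Delta> \<in> carrier R" and eq: "\<Delta> <#\<^bsub>R\<^esub> carrier R = carrier R #>\<^bsub>R\<^esub> \<Delta>"
    using assms(2) by (auto simp: normal_element_def)
  have left: "x \<in> \<Delta> <#\<^bsub>R\<^esub> carrier R \<longleftrightarrow> (\<exists>a\<in>carrier R. x = \<Delta> \<otimes>\<^bsub>R\<^esub> a)" for x
    by (auto simp: l_coset_def)
  have right: "x \<in> \<Delta> <#\<^bsub>R\<^esub> carrier R \<longleftrightarrow> (\<exists>a\<in>carrier R. x = a \<otimes>\<^bsub>R\<^esub> \<Delta>)" for x
    unfolding eq by (auto simp: r_coset_def)
  show ?thesis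
  proof (rule idealI)
    show "subgroup (\<Delta> <#\<^bsub>R\<^esub> carrier R) (add_monoid R)"
    proof (rule add.subgroupI)
      show "\<Delta> <#\<^bsub>R\<^esub> carrier R \<subseteq> carrier R"
        using \<Delta> by (auto simp: left)
      show "\<Delta> <#\<^bsub>R\<^esub> carrier R \<noteq> {}"
        using left by blast
    next
      fix a assume "a \<in> \<Delta> <#\<^bsub>R\<^esub> carrier R"
      then show "\<ominus>\<^bsub>R\<^esub> a \<in> \<Delta> <#\<^bsub>R\<^esub> carrier R"
        unfolding left using \<Delta> by (metis a_inv_closed r_minus)
    next
      fix a b assume "a \<in> \<Delta> <#\<^bsub>R\<^esub> carrier R" "b \<in> \<Delta> <#\<^bsub>R\<^esub> carrier R"
      then show "a \<oplus>\<^bsub>R\<^esub> b \<in> \<Delta> <#\<^bsub>R\<^esub> carrier R"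
        unfolding left using \<Delta> by (metis a_closed r_distr)
    qed
  next
    fix a x assume a: "a \<in> \<Delta> <#\<^bsub>R\<^esub> carrier R" and x: "x \<in> carrier R"
    from a obtain b where "b \<in> carrier R" "a = b \<otimes>\<^bsub>R\<^esub> \<Delta>" unfolding right by blast
    then show "x \<otimes>\<^bsub>R\<^esub> a \<in> \<Delta> <#\<^bsub>R\<^esub> carrier R"
      unfolding right using x \<Delta> by (metis m_assoc m_closed)
    from a obtain b where "b \<in> carrier R" "a = \<Delta> \<otimes>\<^bsub>R\<^esub> b" unfolding left by blast
    then show "a \<otimes>\<^bsub>R\<^esub> x \<in> \<Delta> <#\<^bsub>R\<^esub> carrier R"
      unfolding left using x \<Delta> by (metis m_assoc m_closed)
  qed fact
qed

text \<open>Elementwise form of complete primeness: the product of the two cosets is the zero coset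
  of a domain.\<close>

lemma nc_domain_quotient_mem:
  assumes J: "ideal J R" and dom: "nc_domain (R Quot J)"
    and a: "a \<in> carrier R" and b: "b \<in> carrier R" and ab: "a \<otimes>\<^bsub>R\<^esub> b \<in> J"
  shows "a \<in> J \<or> b \<in> J"
proof -
  interpret J: ideal J R by fact
  interpret Q: nc_domain "R Quot J" by fact
  have carr: "J +>\<^bsub>R\<^esub> a \<in> carrier (R Quot J)" "J +>\<^bsub>R\<^esub> b \<in> carrier (R Quot J)"
    using a b by (auto simp: FactRing_def A_RCOSETS_def')
  have "(J +>\<^bsub>R\<^esub> a) \<otimes>\<^bsub>R Quot J\<^esub> (J +>\<^bsub>R\<^esub> b) = \<zero>\<^bsub>R Quot J\<^esub>"
    using J.rcoset_mult_add[OF a b] J.a_rcos_const[OF ab] by (simp add: FactRing_def)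
  then have "J +>\<^bsub>R\<^esub> a = J \<or> J +>\<^bsub>R\<^esub> b = J"
    using Q.no_zero_divisors[OF carr] by (simp add: FactRing_def)
  then show ?thesis
    using J.rcos_const_imp_mem a b by blast
qed

section \<open>The partially compactified torus\<close>

context torus_fractions
begin

text \<open>The counterpart of \<open>LP_bar\<close> for the initial seed, with the given
  \<open>\<iota>\<close> in place of the chosen \<open>torus_map\<close>.\<close>

definition compactified_torus :: "'i set \<Rightarrow> 'f set"
  where "compactified_torus Ifr = \<iota> ` {p \<in> carrier T. \<forall>m\<in>Poly_Mapping.keys p. \<forall>j\<in>Ifr. Poly_Mapping.lookup m j \<ge> 0}"

lemma compactified_torus_mult:
  assumes "u \<in> compactified_torus Ifr" "v \<in> compactified_torus Ifr"
  shows "u \<otimes> v \<in> compactified_torus Ifr"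
proof -
  obtain p r where p: "u = \<iota> p" "p \<in> carrier T" "\<forall>m\<in>Poly_Mapping.keys p. \<forall>j\<in>Ifr. Poly_Mapping.lookup m j \<ge> 0"
    and r: "v = \<iota> r" "r \<in> carrier T" "\<forall>m\<in>Poly_Mapping.keys r. \<forall>j\<in>Ifr. Poly_Mapping.lookup m j \<ge> 0"
    using assms unfolding compactified_torus_def by blast
  have "Poly_Mapping.keys m \<subseteq> I \<and> (\<forall>j\<in>Ifr. Poly_Mapping.lookup m j \<ge> 0)"
    if m: "m \<in> Poly_Mapping.keys (p \<otimes>\<^bsub>T\<^esub> r)" for m
  proof -
    obtain g h where gh: "m = g + h" "g \<in> Poly_Mapping.keys p" "h \<in> Poly_Mapping.keys r"
      using m by (rule keys_torus_multE)
    then have "Poly_Mapping.keys g \<subseteq> I" "Poly_Mapping.keys h \<subseteq> I"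
      using p r by auto
    then have "Poly_Mapping.keys m \<subseteq> I"
      using keys_add[of g h] unfolding gh(1) by blast
    moreover have "\<forall>j\<in>Ifr. Poly_Mapping.lookup m j \<ge> 0"
      using gh p(3) r(3) by (simp add: lookup_add)
    ultimately show ?thesis ..
  qed
  moreover have "u \<otimes> v = \<iota> (p \<otimes>\<^bsub>T\<^esub> r)"
    unfolding p(1) r(1) by (rule hom_mult[OF p(2) r(2), symmetric])
  ultimately show ?thesis
    unfolding compactified_torus_def by (intro image_eqI[of _ _ "p \<otimes>\<^bsub>T\<^esub> r"]) auto
qed

text \<open>Frozen exponents are already nonnegative, so a monomial in the unfrozen variables alone
  clears all denominators.\<close>

lemma compactified_torus_clear_denominators:
  assumes "I = Iuf \<union> Ifr" and u: "u \<in> compactified_torus Ifr"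
  obtains n p where "n \<in> nonneg_exponents Iuf" "Poly_Mapping.keys p \<subseteq> nonneg_exponents I"
    "\<iota> (tmono n) \<otimes> u = \<iota> p"
proof -
  obtain p where p: "u = \<iota> p" "p \<in> carrier T" "\<And>m j. m \<in> Poly_Mapping.keys p \<Longrightarrow> j \<in> Ifr \<Longrightarrow> Poly_Mapping.lookup m j \<ge> 0"
    using u unfolding compactified_torus_def by blast
  obtain n where n: "n \<in> nonneg_exponents Iuf"
      and pn: "\<And>m. m \<in> Poly_Mapping.keys p \<Longrightarrow> m + n \<in> nonneg_exponents I"
  proof (rule clear_denominators[of "Poly_Mapping.keys p" I Iuf])
    show "Poly_Mapping.lookup m i \<ge> 0" if "m \<in> Poly_Mapping.keys p" "i \<in> I - Iuf" for m i
      using that p(3) assms(1) by blast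
  qed (use p(2) assms(1) in auto)
  have "Poly_Mapping.keys (tmono n \<otimes>\<^bsub>T\<^esub> p) \<subseteq> nonneg_exponents I"
  proof
    fix m assume "m \<in> Poly_Mapping.keys (tmono n \<otimes>\<^bsub>T\<^esub> p)"
    then obtain h where "m = n + h" "h \<in> Poly_Mapping.keys p"
      by (rule keys_torus_multE) simp
    then show "m \<in> nonneg_exponents I"
      using pn[of h] by (simp add: add.commute)
  qed
  moreover have "tmono n \<in> carrier T"
    using n assms(1) by (auto simp: nonneg_exponents_def)
  then have "\<iota> (tmono n) \<otimes> u = \<iota> (tmono n \<otimes>\<^bsub>T\<^esub> p)"
    unfolding p(1) by (rule hom_mult[OF _ p(2), symmetric])
  ultimately show thesis
    using n that by blast
qed

text \<open>Every exponent in the support of the right-hand side has coordinate at least 1 at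
  \<open>j\<close>, while \<open>n\<close> has coordinate 0 there. Injectivity of
  \<open>\<iota>\<close> moves the comparison into the torus.\<close>

lemma tmono_not_multiple:
  assumes "j \<in> Ifr" "j \<in> I" "Poly_Mapping.keys n \<subseteq> I" "j \<notin> Poly_Mapping.keys n"
    and v: "v \<in> compactified_torus Ifr"
  shows "\<iota> (tmono n) \<noteq> \<iota> (tmono (std_basis j)) \<otimes> v"
proof
  assume eq: "\<iota> (tmono n) = \<iota> (tmono (std_basis j)) \<otimes> v"
  obtain p where p: "v = \<iota> p" "p \<in> carrier T" "\<forall>m\<in>Poly_Mapping.keys p. \<forall>j\<in>Ifr. Poly_Mapping.lookup m j \<ge> 0"
    using v unfolding compactified_torus_def by blast
  let ?q = "tmono (std_basis j) \<otimes>\<^bsub>T\<^esub> p"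
  have e: "tmono (std_basis j) \<in> carrier T" using assms by simp
  have keys: "\<exists>h\<in>Poly_Mapping.keys p. m = std_basis j + h" if "m \<in> Poly_Mapping.keys ?q" for m
    using that by (rule keys_torus_multE) simp
  have "Poly_Mapping.keys m \<subseteq> I" if m: "m \<in> Poly_Mapping.keys ?q" for m
  proof -
    obtain h where h: "h \<in> Poly_Mapping.keys p" "m = std_basis j + h" using keys[OF m] by blast
    then show ?thesis
      using p(2) assms(2) keys_add[of "std_basis j" h] by auto
  qed
  then have q: "?q \<in> carrier T" by simp
  have "\<iota> (tmono n) = \<iota> ?q"
    unfolding eq p(1) by (rule hom_mult[OF e p(2), symmetric])
  then have "tmono n = ?q"
    using assms(3) by (intro iota_inject q) auto
  then have "n \<in> Poly_Mapping.keys ?q"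
    by (metis insertI1 keys_tmono)
  then obtain h where "h \<in> Poly_Mapping.keys p" "n = std_basis j + h" using keys by blast
  then have "Poly_Mapping.lookup n j \<ge> 1"
    using p(3) assms(1) by (simp add: lookup_add lookup_std_basis)
  then show False
    using assms(4) by (simp add: in_keys_iff)
qed

end

section \<open>Image subrings and injectivity of localization\<close>

lemma alg_hom_image_subring:
  assumes "ring A" "ring F" "\<phi> \<in> ring_hom A F"
  shows "subring (\<phi> ` carrier A) F"
proof -
  interpret ring_hom_ring A F \<phi> using assms by (simp add: ring_hom_ringI2)
  show ?thesis by (rule img_is_subring[OF R.carrier_is_subring])
qed

lemma mult_closure_subset:
  assumes "monoid A" "G \<subseteq> carrier A"
  shows "mult_closure A G \<subseteq> carrier A"
proof
  interpret monoid A by fact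
  fix s assume "s \<in> mult_closure A G"
  then show "s \<in> carrier A"
    by induction (use assms in auto)
qed

lemma (in nc_domain) mult_closure_nonzero:
  assumes "G \<subseteq> carrier R - {\<zero>}" "s \<in> mult_closure R G"
  shows "s \<noteq> \<zero>"
proof -
  \<comment> \<open>Membership in the carrier is added to the induction because
    \<open>no_zero_divisors\<close> needs it.\<close>
  have "s \<noteq> \<zero> \<and> s \<in> carrier R"
    using assms(2) by induction (use assms(1) one_not_zero no_zero_divisors in auto)
  then show ?thesis ..
qed

text \<open>An element of the kernel is killed by some \<open>s\<close> in \<open>S\<close>; as
  \<open>s\<close> is nonzero and \<open>R\<close> is a domain, the element is zero.\<close>

lemma (in nc_domain) ring_of_fractions_inj_on:
  assumes S: "S \<subseteq> carrier R" "\<zero> \<notin> S" and frac: "ring_of_fractions R S L \<eta>"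
  shows "inj_on \<eta> (carrier R)"
proof -
  interpret L: ring L using frac by (simp add: ring_of_fractions_def)
  interpret h: ring_hom_ring R L \<eta>
    using frac ring_axioms L.ring_axioms by (simp add: ring_of_fractions_def ring_hom_ringI2)
  have "a = \<zero>" if "a \<in> carrier R" "\<eta> a = \<zero>\<^bsub>L\<^esub>" for a
  proof -
    have "\<exists>s\<in>S. a \<otimes> s = \<zero>"
      using frac that by (simp add: ring_of_fractions_def)
    then obtain s where s: "s \<in> S" "a \<otimes> s = \<zero>" ..
    then have "s \<in> carrier R" "s \<noteq> \<zero>" using S by auto
    then show ?thesis
      using no_zero_divisors[of a s] that(1) s(2) by simp
  qed
  moreover have "\<eta> \<zero> = \<zero>\<^bsub>L\<^esub>" by (rule h.hom_zero)
  ultimately have "a_kernel R L \<eta> = {\<zero>}"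
    unfolding a_kernel_def' by blast
  then show ?thesis
    by (rule h.trivial_ker_imp_inj)
qed

theorem theoremC:
  fixes qh :: "'k::comm_ring_1"
    and Iuf Ifr :: "'i set"
    and s :: "('i, 'f) quantum_seed"
    and F :: "('k, 'f) module"
    and \<iota> :: "('k, 'i) laurent \<Rightarrow> 'f"
    and A :: "('k, 'a) module"
    and x :: "'i \<Rightarrow> 'a"
    and L :: "('k, 'l) module"
    and \<eta> :: "'a \<Rightarrow> 'l"
    and \<psi> :: "'l \<Rightarrow> 'f"
  assumes base: "quantum_base_ring qh"
    and seed: "initial_seed qh Iuf Ifr F \<iota> s"
    and algebra: "nc_algebra (ring_of_type_algebra :: 'k ring) A"
    and domain: "nc_domain A"
    and prime: "\<And>j. j \<in> Ifr \<Longrightarrow> prime_element A (x j)"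
    and localization: "alg_localization (ring_of_type_algebra :: 'k ring) A (x ` Ifr) L \<eta>"
    and iso: "\<psi> \<in> alg_iso (ring_of_type_algebra :: 'k ring) L (upper_algebra qh Iuf Ifr F s)"
    and A_sub: "(\<psi> \<circ> \<eta>) ` carrier A \<subseteq> upper_bar qh Iuf Ifr F s"
    and initial_vars: "cvar s ` (Iuf \<union> Ifr) \<subseteq> (\<psi> \<circ> \<eta>) ` carrier A"
    and frozen_vars: "cvar s ` Ifr = (\<psi> \<circ> \<eta>) ` x ` Ifr"
  shows "(\<psi> \<circ> \<eta>) ` carrier A = upper_bar qh Iuf Ifr F s"
proof -
  let ?I = "Iuf \<union> Ifr"
  let ?S = "mult_closure A (x ` Ifr)"
  define \<phi> where "\<phi> = \<psi> \<circ> \<eta>"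
  define B where "B = \<phi> ` carrier A"
  interpret A: nc_domain A by (rule domain)
  interpret Aalg: nc_algebra "base_alg :: 'k ring" A by (rule algebra)
  have disjoint: "Iuf \<inter> Ifr = {}"
    and gens: "\<And>i. i \<in> ?I \<Longrightarrow> cvar s i = \<iota> (tmono (std_basis i))"
    using seed by (auto simp: initial_seed_def)
  interpret torus_fractions qh ?I "quasi s" F \<iota>
    using seed base by unfold_locales (auto simp: initial_seed_def quantum_base_ring_dvd_one)

  have LP: "LP_bar qh Iuf Ifr F s = compactified_torus Ifr"
    unfolding LP_bar_def compactified_torus_def
    by (intro image_cong refl torus_map_eq gens) auto
  have bar_LP: "upper_bar qh Iuf Ifr F s \<subseteq> compactified_torus Ifr"
    unfolding LP[symmetric] upper_bar_def using mutation_class.initial by fast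

  have frac: "ring_of_fractions A ?S L \<eta>" and \<eta>: "\<eta> \<in> alg_hom base_alg A L"
    using localization by (auto simp: alg_localization_def)
  have \<psi>: "\<psi> \<in> alg_hom base_alg L (upper_algebra qh Iuf Ifr F s)" "inj_on \<psi> (carrier L)"
    and \<psi>_onto: "\<psi> ` carrier L = upper qh Iuf Ifr F s"
    using iso by (auto simp: alg_iso_def bij_betw_def upper_algebra_def)
  have \<eta>_closed: "\<eta> a \<in> carrier L" if "a \<in> carrier A" for a
    using that \<eta> by (auto simp: alg_hom_def ring_hom_def)
  \<comment> \<open>That \<open>\<phi>\<close> takes values in \<open>F\<close> is obtained from
    here, through \<open>A_sub\<close>.\<close>
  have B_LP: "B \<subseteq> compactified_torus Ifr"
    using A_sub bar_LP by (simp add: B_def \<phi>_def)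
  have "compactified_torus Ifr \<subseteq> carrier F"
    unfolding compactified_torus_def by (auto simp del: quantum_torus_simps)
  then have B_F: "B \<subseteq> carrier F" using B_LP by blast
  have \<phi>_closed [simp]: "\<phi> a \<in> carrier F" if "a \<in> carrier A" for a
    using that B_F by (auto simp: B_def)
  \<comment> \<open>\<open>upper_algebra\<close> differs from \<open>F\<close> only in its carrier,
    so its operations are those of \<open>F\<close>.\<close>
  have \<phi>_mult: "\<phi> (a \<otimes>\<^bsub>A\<^esub> b) = \<phi> a \<otimes>\<^bsub>F\<^esub> \<phi> b" if "a \<in> carrier A" "b \<in> carrier A" for a b
    using that \<eta> \<psi>(1) \<eta>_closed by (auto simp: alg_hom_def ring_hom_def upper_algebra_def \<phi>_def)
  have \<phi>_hom: "\<phi> \<in> ring_hom A F"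
    using \<eta> \<psi>(1) \<eta>_closed \<phi>_closed by (auto simp: alg_hom_def ring_hom_def upper_algebra_def \<phi>_def)
  have \<phi>_smult: "\<phi> (c \<odot>\<^bsub>A\<^esub> a) = c \<odot>\<^bsub>F\<^esub> \<phi> a" if "a \<in> carrier A" for a c
    using that \<eta> \<psi>(1) \<eta>_closed by (auto simp: alg_hom_def ring_hom_def upper_algebra_def \<phi>_def)
  have B_subring: "subring B F"
    unfolding B_def by (rule alg_hom_image_subring[OF A.ring_axioms F.ring_axioms \<phi>_hom])
  have B_smult: "c \<odot>\<^bsub>F\<^esub> b \<in> B" if "b \<in> B" for b c
  proof -
    obtain a where a: "a \<in> carrier A" "b = \<phi> a" using \<open>b \<in> B\<close> unfolding B_def by blast
    have "c \<odot>\<^bsub>A\<^esub> a \<in> carrier A" using a(1) by simp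
    then show ?thesis
      unfolding a(2) \<phi>_smult[OF a(1), symmetric] B_def by (rule imageI)
  qed

  have x: "x j \<in> carrier A" "x j \<noteq> \<zero>\<^bsub>A\<^esub>" if "j \<in> Ifr" for j
    using prime[OF that] by (auto simp: prime_element_def normal_element_def)
  have S: "?S \<subseteq> carrier A" "\<zero>\<^bsub>A\<^esub> \<notin> ?S"
  proof -
    have G: "x ` Ifr \<subseteq> carrier A - {\<zero>\<^bsub>A\<^esub>}" using x by auto
    then show "?S \<subseteq> carrier A"
      by (intro mult_closure_subset A.monoid_axioms) auto
    show "\<zero>\<^bsub>A\<^esub> \<notin> ?S"
      using A.mult_closure_nonzero[OF G] by blast
  qed
  have "inj_on \<eta> (carrier A)"
    by (rule A.ring_of_fractions_inj_on[OF S frac])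
  moreover have "\<eta> ` carrier A \<subseteq> carrier L"
    using \<eta>_closed by blast
  ultimately have \<phi>_inj: "inj_on \<phi> (carrier A)"
    unfolding \<phi>_def using \<psi>(2) by (intro comp_inj_on) (auto intro: inj_on_subset)

  have divide: "u \<in> B" if u: "u \<in> compactified_torus Ifr" and j: "j \<in> Ifr" and ux: "u \<otimes>\<^bsub>F\<^esub> \<phi> (x j) \<in> B" for u j
  proof -
    let ?J = "x j <#\<^bsub>A\<^esub> carrier A"
    have u_F: "u \<in> carrier F" using u \<open>compactified_torus Ifr \<subseteq> carrier F\<close> by blast
    have normal: "normal_element A (x j)" and quot: "nc_domain (A Quot ?J)"
      using prime[OF j] by (auto simp: prime_element_def)
    have J: "ideal ?J A" by (rule normal_element_ideal[OF A.ring_axioms normal])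
    \<comment> \<open>The ideal is defined by left cosets, but below \<open>x j\<close> appears as a
      right factor.\<close>
    have J_eq: "?J = carrier A #>\<^bsub>A\<^esub> x j" using normal by (simp add: normal_element_def)
    obtain j' where j': "j' \<in> Ifr" "\<phi> (x j) = \<iota> (tmono (std_basis j'))"
    proof -
      have "\<phi> (x j) \<in> cvar s ` Ifr" using frozen_vars j by (auto simp: \<phi>_def)
      then show thesis using that gens by auto
    qed
    obtain a where a: "a \<in> carrier A" "u \<otimes>\<^bsub>F\<^esub> \<phi> (x j) = \<phi> a" using ux unfolding B_def by blast
    obtain n p where n: "n \<in> nonneg_exponents Iuf" and p: "Poly_Mapping.keys p \<subseteq> nonneg_exponents ?I"
      and np: "\<iota> (tmono n) \<otimes>\<^bsub>F\<^esub> u = \<iota> p"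
      using compactified_torus_clear_denominators[OF refl u] by blast
    have poly: "\<iota> q \<in> B" if "Poly_Mapping.keys q \<subseteq> nonneg_exponents ?I" for q
    proof (rule hom_poly_mem[OF B_subring B_smult subset_refl _ that])
      fix i assume "i \<in> ?I"
      then show "\<iota> (tmono (std_basis i)) \<in> B"
        using subsetD[OF initial_vars imageI] gens unfolding B_def \<phi>_def by metis
    qed
    obtain b where b: "b \<in> carrier A" "\<iota> p = \<phi> b" using poly[OF p] unfolding B_def by blast
    have n_I: "n \<in> nonneg_exponents ?I" using n nonneg_exponents_mono[of Iuf ?I] by blast
    obtain w where w: "w \<in> carrier A" "\<iota> (tmono n) = \<phi> w"
    proof -
      have "\<iota> (tmono n) \<in> B" by (rule poly) (use n_I in simp)
      then show thesis using that unfolding B_def by blast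
    qed
    have "w \<notin> ?J"
    proof
      assume "w \<in> ?J"
      then obtain c where c: "c \<in> carrier A" "w = x j \<otimes>\<^bsub>A\<^esub> c" by (auto simp: l_coset_def)
      then have "\<iota> (tmono n) = \<iota> (tmono (std_basis j')) \<otimes>\<^bsub>F\<^esub> \<phi> c"
        using w j' x[OF j] by (simp add: \<phi>_mult)
      moreover have "\<phi> c \<in> compactified_torus Ifr" using c B_LP by (auto simp: B_def)
      moreover have "j' \<notin> Poly_Mapping.keys n" "Poly_Mapping.keys n \<subseteq> ?I"
        using n j'(1) disjoint by (auto simp: nonneg_exponents_def)
      ultimately show False
        using tmono_not_multiple[of j' Ifr n "\<phi> c"] j'(1) by blast
    qed
    moreover have "w \<otimes>\<^bsub>A\<^esub> a \<in> ?J"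
    proof -
      have "\<phi> (w \<otimes>\<^bsub>A\<^esub> a) = \<phi> w \<otimes>\<^bsub>F\<^esub> (u \<otimes>\<^bsub>F\<^esub> \<phi> (x j))"
        using a w by (simp add: \<phi>_mult)
      also have "\<dots> = \<phi> b \<otimes>\<^bsub>F\<^esub> \<phi> (x j)"
        using w b np u_F x[OF j] by (simp add: F.m_assoc[symmetric])
      also have "\<dots> = \<phi> (b \<otimes>\<^bsub>A\<^esub> x j)"
        using b x[OF j] by (simp add: \<phi>_mult)
      finally have "w \<otimes>\<^bsub>A\<^esub> a = b \<otimes>\<^bsub>A\<^esub> x j"
        using \<phi>_inj a b w x[OF j] by (auto dest: inj_onD)
      then show ?thesis
        unfolding J_eq using b by (auto simp: r_coset_def)
    qed
    ultimately have "a \<in> ?J"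
      using nc_domain_quotient_mem[OF J quot w(1) a(1)] by blast
    then obtain c where c: "c \<in> carrier A" "a = c \<otimes>\<^bsub>A\<^esub> x j"
      unfolding J_eq by (auto simp: r_coset_def)
    \<comment> \<open>A torus monomial is invertible in \<open>F\<close>, so the common right factor
      can be cancelled.\<close>
    have unit: "\<phi> (x j) \<in> Units F"
      unfolding j'(2) by (rule tmono_unit) (use j'(1) in auto)
    have "u \<otimes>\<^bsub>F\<^esub> \<phi> (x j) = \<phi> c \<otimes>\<^bsub>F\<^esub> \<phi> (x j)"
      using a c x[OF j] by (simp add: \<phi>_mult)
    then have "u \<otimes>\<^bsub>F\<^esub> \<phi> (x j) \<otimes>\<^bsub>F\<^esub> inv\<^bsub>F\<^esub> \<phi> (x j) = \<phi> c \<otimes>\<^bsub>F\<^esub> \<phi> (x j) \<otimes>\<^bsub>F\<^esub> inv\<^bsub>F\<^esub> \<phi> (x j)"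
      by simp
    then have "u = \<phi> c"
      using u_F c unit x[OF j] by (simp add: F.m_assoc)
    then show ?thesis using c by (auto simp: B_def)
  qed

  \<comment> \<open>\<open>u\<close> must vary: for a product of \<open>t\<close> and
    \<open>t'\<close>, the hypothesis for \<open>t'\<close> is applied to \<open>u\<close> times
    \<open>\<phi> t\<close>, and then the one for \<open>t\<close> to \<open>u\<close>.\<close>
  have divide_S: "u \<in> B" if "t \<in> ?S" "u \<in> compactified_torus Ifr" "u \<otimes>\<^bsub>F\<^esub> \<phi> t \<in> B" for t u
    using that
  proof (induction arbitrary: u rule: mult_closure.induct)
    case one
    have "u \<in> carrier F" using one \<open>compactified_torus Ifr \<subseteq> carrier F\<close> by blast
    then show ?case
      using one ring_hom_one[OF \<phi>_hom] by simp
  next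
    case (incl t)
    then show ?case using divide by blast
  next
    case (mult t t')
    have carr: "t \<in> carrier A" "t' \<in> carrier A" "u \<in> carrier F"
      using mult S \<open>compactified_torus Ifr \<subseteq> carrier F\<close> by auto
    then have "u \<otimes>\<^bsub>F\<^esub> \<phi> t \<otimes>\<^bsub>F\<^esub> \<phi> t' \<in> B"
      using mult.prems(2) by (simp add: \<phi>_mult F.m_assoc)
    moreover have "u \<otimes>\<^bsub>F\<^esub> \<phi> t \<in> compactified_torus Ifr"
      using mult.prems(1) carr B_LP by (intro compactified_torus_mult) (auto simp: B_def)
    ultimately show ?case
      using mult.IH mult.prems(1) by blast
  qed

  have "upper_bar qh Iuf Ifr F s \<subseteq> B"
  proof
    fix u assume u: "u \<in> upper_bar qh Iuf Ifr F s"
    then have "u \<in> upper qh Iuf Ifr F s"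
      unfolding upper_def by (intro generate_ring.incl) simp
    then obtain y where y: "y \<in> carrier L" "u = \<psi> y"
      using \<psi>_onto by blast
    interpret L: ring L using frac by (simp add: ring_of_fractions_def)
    \<comment> \<open>Fractions have their denominators on the right, so multiplying
      \<open>u\<close> by \<open>\<phi> t\<close> on the right lands in \<open>B\<close>, as
      \<open>divide_S\<close> expects.\<close>
    obtain a t where a: "a \<in> carrier A" and t: "t \<in> ?S" and y_eq: "y = \<eta> a \<otimes>\<^bsub>L\<^esub> inv\<^bsub>L\<^esub> \<eta> t"
      and unit: "\<eta> t \<in> Units L"
      using frac y(1) unfolding ring_of_fractions_def by blast
    have "\<eta> a \<in> carrier L" using a by (rule \<eta>_closed)
    then have "y \<otimes>\<^bsub>L\<^esub> \<eta> t = \<eta> a"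
      unfolding y_eq using unit by (simp add: L.m_assoc L.Units_closed)
    moreover have "\<psi> (y \<otimes>\<^bsub>L\<^esub> \<eta> t) = u \<otimes>\<^bsub>F\<^esub> \<phi> t"
      using \<psi>(1) y L.Units_closed[OF unit]
      by (auto simp: \<phi>_def alg_hom_def ring_hom_def upper_algebra_def)
    ultimately have "u \<otimes>\<^bsub>F\<^esub> \<phi> t = \<phi> a"
      by (simp add: \<phi>_def)
    then show "u \<in> B"
      using divide_S[OF t] u bar_LP a by (auto simp: B_def)
  qed
  then show ?thesis
    using A_sub by (auto simp: B_def \<phi>_def)
qed

end
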